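(* Let $\mathbb{K}$ be a field, let $\Gamma=\boldsymbol{\lambda}/\boldsymbol{\mu}$ be a skew Ferrers diagram with associated bipartite graph $\mathcal{G}$, and let $\boldsymbol{P}=\boldsymbol{P}_{NW}(\Gamma)\sqcup\boldsymbol{P}_{SE}(\Gamma)$ be the set of its northwestern and southeastern perimeter cells. Then the Krull dimension of the binomial edge ring $\mathbb{K}[G(J_{\mathcal{G}})]$ is equal to the cardinality $\#\boldsymbol{P}$.
   Context: Let $a\ge1$, $\boldsymbol{\lambda}=(\lambda_1\ge\cdots\ge\lambda_a)\in\mathbb{Z}_{\ge1}^a$, $\boldsymbol{\mu}=(\mu_1\ge\cdots\ge\mu_a)\in\mathbb{Z}_{\ge0}^a$ with $\lambda_i\ge\mu_i$ for all $i$, and $b=\lambda_1$. The skew Ferrers diagram is the set of cells $\Gamma=\{(i,j)\in\mathbb{Z}^2\mid1\le i\le a,\ \mu_i<j\le\lambda_i\}$. The bipartite graph $\mathcal{G}$ has vertices $\{x_1,\dots,x_a\}\sqcup\{y_1,\dots,y_b\}$ and edges $\{x_i,y_j\}$ for $(i,j)\in\Gamma$. Let $S=\mathbb{K}[x_1,\dots,x_a,p_1,\dots,p_b,q_1,\dots,q_a,y_1,\dots,y_b]$ and $G(J_{\mathcal{G}})=\{x_iy_j-p_jq_i\mid(i,j)\in\Gamma\}$. The binomial edge ring $\mathbb{K}[G(J_{\mathcal{G}})]$ is the $\mathbb{K}$-subalgebra of $S$ generated by $G(J_{\mathcal{G}})$. A cell $(i,j)\in\Gamma$ is a northwestern perimeter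 cell if $(i-1,j-1)\notin\Gamma$. It is a southeastern perimeter cell if $(i-1,j-1)\in\Gamma$ but $(i+1,j+1)\notin\Gamma$. The sets of these cells are denoted $\boldsymbol{P}_{NW}(\Gamma)$ and $\boldsymbol{P}_{SE}(\Gamma)$, respectively. *)

theory Defs
  imports
    "HOL-Library.Poly_Mapping"
    "HOL-Library.Extended_Nat"
    "HOL-Algebra.Generated_Rings"
begin

section \<open>Krull dimension\<close>

text \<open>
  The supremum of the lengths \<open>n\<close> of chains \<open>p 0 \<subset> \<dots> \<subset> p n\<close> of prime ideals.
  The zero ring has no prime ideals and gets the value \<open>0\<close> here.
\<close>
definition krull_dim :: "('a, 'm) ring_scheme \<Rightarrow> enat" where
  "krull_dim R =
     Sup {enat n | n. \<exists>p :: nat \<Rightarrow> 'a set.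
       (\<forall>i\<le>n. primeideal (p i) R) \<and> (\<forall>i<n. p i \<subset> p (Suc i))}"


section \<open>Skew Ferrers diagrams\<close>

definition skew_diagram :: "int \<Rightarrow> (int \<Rightarrow> int) \<Rightarrow> (int \<Rightarrow> int) \<Rightarrow> (int \<times> int) set" where
  "skew_diagram a lam mu = {(i, j). 1 \<le> i \<and> i \<le> a \<and> mu i < j \<and> j \<le> lam i}"

definition NW_perimeter :: "(int \<times> int) set \<Rightarrow> (int \<times> int) set" where
  "NW_perimeter \<Gamma> = {(i, j) \<in> \<Gamma>. (i - 1, j - 1) \<notin> \<Gamma>}"

definition SE_perimeter :: "(int \<times> int) set \<Rightarrow> (int \<times> int) set" where
  "SE_perimeter \<Gamma> = {(i, j) \<in> \<Gamma>. (i - 1, j - 1) \<in> \<Gamma> \<and> (i + 1, j + 1) \<notin> \<Gamma>}"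

lemma perimeter_disjoint: "NW_perimeter \<Gamma> \<inter> SE_perimeter \<Gamma> = {}"
  by (auto simp: NW_perimeter_def SE_perimeter_def)


section \<open>The ambient polynomial ring\<close>

text \<open>
  \<open>XV i\<close>, \<open>PV j\<close>, \<open>QV i\<close>, \<open>YV j\<close> stand for $x_i$, $p_j$, $q_i$, $y_j$.
\<close>
datatype edge_var = XV int | PV int | QV int | YV int

text \<open>
  A polynomial maps each monomial, i.e. each finitely supported exponent vector, to its
  coefficient. The type has infinitely many variables; the ring \<open>S\<close> is cut out by its carrier.
\<close>
type_synonym 'k edge_poly = "(edge_var \<Rightarrow>\<^sub>0 nat) \<Rightarrow>\<^sub>0 'k"

definition Const :: "'k::field \<Rightarrow> 'k edge_poly" where
  "Const c = Poly_Mapping.single 0 c"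

definition Var :: "edge_var \<Rightarrow> 'k::field edge_poly" where
  "Var v = Poly_Mapping.single (Poly_Mapping.single v 1) 1"

definition S_vars :: "int \<Rightarrow> int \<Rightarrow> edge_var set" where
  "S_vars a b = XV ` {1..a} \<union> PV ` {1..b} \<union> QV ` {1..a} \<union> YV ` {1..b}"

definition S_ring :: "int \<Rightarrow> int \<Rightarrow> 'k::field edge_poly ring" where
  "S_ring a b =
     \<lparr>carrier = {f. \<forall>m \<in> Poly_Mapping.keys f. Poly_Mapping.keys m \<subseteq> S_vars a b},
      mult = (*), one = 1, zero = 0, add = (+)\<rparr>"


section \<open>The bipartite graph and its binomial edge ring\<close>

text \<open>A graph is given as the pair of its vertex set and its set of (two-element) edges.\<close>
definition ferrers_graph ::
    "int \<Rightarrow> int \<Rightarrow> (int \<times> int) set \<Rightarrow> edge_var set \<times> edge_var set set" where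
  "ferrers_graph a b \<Gamma> =
     (XV ` {1..a} \<union> YV ` {1..b}, {{XV i, YV j} | i j. (i, j) \<in> \<Gamma>})"

definition edge_binomials :: "edge_var set \<times> edge_var set set \<Rightarrow> 'k::field edge_poly set" where
  "edge_binomials \<G> =
     {Var (XV i) * Var (YV j) - Var (PV j) * Var (QV i) | i j. {XV i, YV j} \<in> snd \<G>}"

text \<open>
  The \<open>K\<close>-subalgebra of \<open>S\<close> generated by the binomials is the subring generated by
  the constants together with the binomials.
\<close>
definition binomial_edge_ring ::
    "int \<Rightarrow> int \<Rightarrow> edge_var set \<times> edge_var set set \<Rightarrow> 'k::field edge_poly ring" where
  "binomial_edge_ring a b \<G> =
     (S_ring a b)\<lparr>carrier := generate_ring (S_ring a b) (range Const \<union> edge_binomials \<G>)\<rparr>"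

lemma edge_binomials_ferrers_graph:
  "edge_binomials (ferrers_graph a b \<Gamma>) =
     {Var (XV i) * Var (YV j) - Var (PV j) * Var (QV i) | i j. (i, j) \<in> \<Gamma>}"
  by (auto simp: edge_binomials_def ferrers_graph_def doubleton_eq_iff)

lemma S_ring_closed:
  fixes f g :: "'k::field edge_poly"
  assumes "f \<in> carrier (S_ring a b)" "g \<in> carrier (S_ring a b)"
  shows "f + g \<in> carrier (S_ring a b)" "- f \<in> carrier (S_ring a b)"
    "f - g \<in> carrier (S_ring a b)" "f * g \<in> carrier (S_ring a b)"
proof -
  show "f + g \<in> carrier (S_ring a b)"
    using assms keys_add[of f g] unfolding S_ring_def by fastforce
  show "- f \<in> carrier (S_ring a b)"
    using assms unfolding S_ring_def by simp
  show "f - g \<in> carrier (S_ring a b)"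
    using assms keys_diff[of f g] unfolding S_ring_def by fastforce
  have "Poly_Mapping.keys m \<subseteq> S_vars a b" if m: "m \<in> Poly_Mapping.keys (f * g)" for m
  proof -
    obtain m1 m2 where "m = m1 + m2" "m1 \<in> Poly_Mapping.keys f" "m2 \<in> Poly_Mapping.keys g"
      using keys_mult[of f g] m by blast
    then show ?thesis
      using assms keys_add[of m1 m2] unfolding S_ring_def by fastforce
  qed
  then show "f * g \<in> carrier (S_ring a b)"
    unfolding S_ring_def by simp
qed

lemma cring_S_ring: "cring (S_ring a b :: 'k::field edge_poly ring)"
proof (rule cringI)
  let ?S = "S_ring a b :: 'k edge_poly ring"
  have [simp]: "add ?S = (+)" "mult ?S = (*)" "zero ?S = 0" "one ?S = 1"
    by (simp_all add: S_ring_def)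
  have z: "0 \<in> carrier ?S" and o: "1 \<in> carrier ?S"
    by (simp_all add: S_ring_def)
  show "abelian_group ?S"
    by (rule abelian_groupI) (auto simp: z S_ring_closed algebra_simps
        intro!: bexI[where x = "- x" for x])
  show "Group.comm_monoid ?S"
    by (rule comm_monoidI) (auto simp: o S_ring_closed algebra_simps)
qed (simp add: S_ring_def algebra_simps)

lemma Const_in_S_ring: "Const c \<in> carrier (S_ring a b)"
  by (simp add: S_ring_def Const_def)

lemma Var_in_S_ring: "v \<in> S_vars a b \<Longrightarrow> Var v \<in> carrier (S_ring a b)"
  by (simp add: S_ring_def Var_def)

end

theory Submission
  imports Defs
begin

text \<open>
  Write \<open>c i j\<close> for the binomial of the cell \<open>(i, j)\<close>. The matrix of these binomials is the product
  of the matrix with rows \<open>(x i, q i)\<close> and the matrix with columns \<open>(y j, - p j)\<close>, so it has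
  rank two: its 3 by 3 minors vanish. The dimension is computed from the cells of \<open>\<Gamma>\<close> that are the
  first or the second one on their diagonal (\<open>NW_layers\<close>). Since \<open>\<Gamma>\<close> meets each diagonal in a
  contiguous segment, replacing the second cell by the last one shows that there are as many of
  them as perimeter cells (\<open>card_NW_layers\<close>).

  Upper bound. If \<open>(i - 2, j - 2)\<close> is in \<open>\<Gamma>\<close>, so is the whole 3 by 3 block with southeastern corner
  \<open>(i, j)\<close>, and its vanishing minor expresses \<open>c i j\<close> as a rational function of the binomials of the
  other eight cells. Hence every element of the edge ring is a rational function of the binomials
  of the two layers (\<open>cell_binomial_in_fractions\<close>). On the other hand, elements chosen along a
  strict chain of primes, one in each prime but not in the previous one, are algebraically
  independent (\<open>chain_independent\<close>). Comparing the numbers of monomials shows that a chain cannot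
  be longer than the number of cells in the layers (\<open>chain_length_le\<close>).

  Lower bound. An ideal generated by variables is prime, and so is its intersection with the edge
  ring. Give integer weights to the variables and let \<open>V s\<close> be the set of variables of weight at
  least \<open>s\<close>. The primes cut out by \<open>V s\<close> form a chain, and \<open>c i j\<close> belongs to the prime of
  \<open>V s\<close> iff \<open>s\<close> is at most \<open>min (max (w (x i)) (w (y j))) (max (w (p j)) (w (q i)))\<close>. The chain
  therefore has at least as many steps as this expression has values (\<open>card_le_krull_dim\<close>). For the
  weights \<open>layer_weight\<close> its value is \<open>2 * (i - j)\<close> on first cells and \<open>2 * (i - j) + 1\<close> on second
  cells of diagonals, so the cells of the two layers all give different values
  (\<open>inj_on_cell_weight\<close>).
\<close>

section \<open>Subrings of a commutative ring type and their prime ideals\<close>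

text \<open>
  Prime ideals are handled inside one ambient ring type: a subring is a set \<open>A\<close>, and
  \<open>ring_on A\<close> turns it into a ring record without changing the operations.
\<close>
definition ring_on :: "'r::comm_ring_1 set \<Rightarrow> 'r ring" where
  "ring_on A = \<lparr>carrier = A, mult = (*), one = 1, zero = 0, add = (+)\<rparr>"

lemma ring_on_simps [simp]:
  "carrier (ring_on A) = A" "mult (ring_on A) = (*)" "one (ring_on A) = 1"
  "zero (ring_on A) = 0" "add (ring_on A) = (+)"
  by (simp_all add: ring_on_def)

locale subring_set =
  fixes A :: "'r::comm_ring_1 set"
  assumes one_mem: "1 \<in> A"
    and uminus_mem: "x \<in> A \<Longrightarrow> - x \<in> A"
    and add_mem: "x \<in> A \<Longrightarrow> y \<in> A \<Longrightarrow> x + y \<in> A"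
    and mult_mem: "x \<in> A \<Longrightarrow> y \<in> A \<Longrightarrow> x * y \<in> A"
begin

lemma zero_mem: "0 \<in> A"
  using add_mem[OF one_mem uminus_mem[OF one_mem]] by simp

lemma power_mem: "x \<in> A \<Longrightarrow> x ^ n \<in> A"
  by (induction n) (auto intro: one_mem mult_mem)

lemma sum_mem: "(\<And>i. i \<in> I \<Longrightarrow> f i \<in> A) \<Longrightarrow> sum f I \<in> A"
  by (induction I rule: infinite_finite_induct) (auto intro: zero_mem add_mem)

lemma prod_mem: "(\<And>i. i \<in> I \<Longrightarrow> f i \<in> A) \<Longrightarrow> prod f I \<in> A"
  by (induction I rule: infinite_finite_induct) (auto intro: one_mem mult_mem)

lemma cring_ring_on: "cring (ring_on A)"
proof (rule cringI)
  show "abelian_group (ring_on A)"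
    by (rule abelian_groupI)
      (auto simp: algebra_simps intro: add_mem zero_mem intro!: bexI[OF _ uminus_mem])
  show "Group.comm_monoid (ring_on A)"
    by (rule comm_monoidI) (auto simp: algebra_simps intro: mult_mem one_mem)
qed (simp add: algebra_simps)

lemma primeideal_ring_onI:
  assumes "p \<subseteq> A" "0 \<in> p" "1 \<notin> p"
    and add: "\<And>x y. x \<in> p \<Longrightarrow> y \<in> p \<Longrightarrow> x + y \<in> p"
    and mult: "\<And>a x. a \<in> A \<Longrightarrow> x \<in> p \<Longrightarrow> a * x \<in> p"
    and prime: "\<And>x y. x \<in> A \<Longrightarrow> y \<in> A \<Longrightarrow> x * y \<in> p \<Longrightarrow> x \<in> p \<or> y \<in> p"
  shows "primeideal p (ring_on A)"
proof -
  interpret cring "ring_on A" by (rule cring_ring_on)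
  have minus: "- x \<in> p" if "x \<in> p" for x
    using mult[OF uminus_mem[OF one_mem] that] by simp
  have "\<ominus>\<^bsub>ring_on A\<^esub> x = - x" if "x \<in> A" for x
    using add.inv_equality[of "- x" x] that uminus_mem[OF that] by simp
  note inv = this[unfolded a_inv_def, simplified]
  have "ideal p (ring_on A)"
  proof (rule idealI)
    show "subgroup p (add_monoid (ring_on A))"
      using assms(1,2) by (intro subgroup.intro) (auto simp: add minus inv subset_iff)
    show "x \<otimes>\<^bsub>ring_on A\<^esub> y \<in> p" "y \<otimes>\<^bsub>ring_on A\<^esub> x \<in> p"
      if "y \<in> p" "x \<in> carrier (ring_on A)" for x y
      using mult[of x y] that by (simp_all add: mult.commute)
  qed (rule ring_axioms)
  then show ?thesis
    using assms(3) prime one_mem by (intro primeidealI cring_ring_on) auto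
qed

lemma primeideal_ring_onD:
  assumes "primeideal p (ring_on A)"
  shows "p \<subseteq> A" "1 \<notin> p" "0 \<in> p"
    "x \<in> p \<Longrightarrow> y \<in> p \<Longrightarrow> x + y \<in> p"
    "a \<in> A \<Longrightarrow> x \<in> p \<Longrightarrow> a * x \<in> p"
    "x \<in> p \<Longrightarrow> - x \<in> p"
    "x \<in> A \<Longrightarrow> y \<in> A \<Longrightarrow> x * y \<in> p \<Longrightarrow> x \<in> p \<or> y \<in> p"
proof -
  interpret primeideal p "ring_on A" by fact
  show "p \<subseteq> A" using a_subset by simp
  show "1 \<notin> p" using I_notcarr one_imp_carrier by auto
  show "0 \<in> p" using additive_subgroup.zero_closed is_additive_subgroup by fastforce
  show "x \<in> p \<Longrightarrow> y \<in> p \<Longrightarrow> x + y \<in> p" using additive_subgroup.a_closed[OF is_additive_subgroup, of x y] by simp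
  show *: "a \<in> A \<Longrightarrow> x \<in> p \<Longrightarrow> a * x \<in> p" for a x using I_l_closed by simp
  show "x \<in> p \<Longrightarrow> - x \<in> p" using *[OF uminus_mem[OF one_mem], of x] by simp
  show "x \<in> A \<Longrightarrow> y \<in> A \<Longrightarrow> x * y \<in> p \<Longrightarrow> x \<in> p \<or> y \<in> p" using I_prime by simp
qed

end

section \<open>Linear dependence by counting monomials\<close>

text \<open>
  Splits off one variable: exponent vectors on \<open>insert l J\<close> are an exponent of \<open>l\<close>
  together with an exponent vector on \<open>J\<close>.
\<close>
lemma sum_PiE_insert:
  fixes g :: "('i \<Rightarrow> 'b) \<Rightarrow> 'c::comm_monoid_add"
  assumes "l \<notin> J"
  shows "sum g (Pi\<^sub>E (insert l J) T) = (\<Sum>t\<in>T l. \<Sum>e\<in>Pi\<^sub>E J T. g (e(l := t)))"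
proof -
  have "sum g (Pi\<^sub>E (insert l J) T) = (\<Sum>(t, e)\<in>T l \<times> Pi\<^sub>E J T. g (e(l := t)))"
    unfolding PiE_insert_eq
    by (subst sum.reindex[OF inj_combinator[OF assms]]) (simp add: case_prod_unfold)
  then show ?thesis
    by (simp add: sum.cartesian_product)
qed

text \<open>
  Monomials in \<open>d + 1\<close> variables eventually outnumber monomials in \<open>d\<close> variables, even
  when the latter may have a degree larger by a constant factor \<open>c\<close>.
\<close>
lemma power_count: "\<exists>k. (c * k + 1) ^ d < (k::nat) ^ Suc d"
proof -
  define k where "k = (c + 1) ^ d + 1"
  have "(c * k + 1) ^ d \<le> ((c + 1) * k) ^ d"
    by (rule power_mono) (simp_all add: k_def)
  also have "\<dots> = (c + 1) ^ d * k ^ d"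
    by (rule power_mult_distrib)
  also have "\<dots> < k * k ^ d"
    by (rule mult_strict_right_mono) (simp_all add: k_def)
  finally show ?thesis by auto
qed

lemma (in vector_space) family_dependent:
  assumes "finite I" "finite T" "card T < card I" and span: "\<And>i. i \<in> I \<Longrightarrow> v i \<in> span T"
  shows "\<exists>u. (\<exists>i\<in>I. u i \<noteq> 0) \<and> (\<Sum>i\<in>I. scale (u i) (v i)) = 0"
proof (cases "inj_on v I")
  case True
  have "dependent (v ` I)"
    using independent_span_bound[OF assms(2), of "v ` I"] assms(3) span card_image[OF True]
    by (auto simp: image_subset_iff)
  then obtain u where "\<exists>x\<in>v ` I. u x \<noteq> 0" "(\<Sum>x\<in>v ` I. scale (u x) x) = 0"
    using dependent_finite[of "v ` I"] assms(1) by auto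
  then show ?thesis
    by (intro exI[of _ "u \<circ> v"]) (auto simp: sum.reindex[OF True])
next
  case False
  then obtain i j where ij: "i \<in> I" "j \<in> I" "i \<noteq> j" "v i = v j"
    by (auto simp: inj_on_def)
  define u :: "_ \<Rightarrow> 'a" where "u l = (if l = i then 1 else if l = j then - 1 else 0)" for l
  have "(\<Sum>l\<in>I. scale (u l) (v l)) = (\<Sum>l\<in>{i, j}. scale (u l) (v l))"
    using assms(1) ij by (intro sum.mono_neutral_right) (auto simp: u_def)
  also have "\<dots> = 0"
    using ij by (simp add: u_def scale_minus_left)
  finally show ?thesis
    using ij by (intro exI[of _ u]) (auto simp: u_def)
qed

text \<open>
  The homomorphism \<open>s\<close> embeds a field of constants into a domain, and multiplication by \<open>s c\<close>
  makes the domain a vector space.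
\<close>
locale field_algebra =
  fixes s :: "'k::field \<Rightarrow> 'r::idom"
  assumes s_add: "s (x + y) = s x + s y"
    and s_mult: "s (x * y) = s x * s y"
    and s_one: "s 1 = 1"
begin

sublocale vector_space "\<lambda>c r. s c * r"
  by unfold_locales (simp_all add: s_add s_mult s_one algebra_simps)

lemma s_zero: "s 0 = 0"
  using scale_zero_left[of 1] by simp

subsection \<open>The filtration of a finitely generated subalgebra\<close>

text \<open>
  Bounding each exponent separately, instead of the total degree, makes the count of monomials
  a plain power.
\<close>
definition monomials :: "'r set \<Rightarrow> nat \<Rightarrow> 'r set" where
  "monomials F k = (\<lambda>e. \<Prod>c\<in>F. c ^ e c) ` (F \<rightarrow>\<^sub>E {..k})"

definition bounded_polys :: "'r set \<Rightarrow> nat \<Rightarrow> 'r set" where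
  "bounded_polys F k = span (monomials F k)"

lemma finite_monomials: "finite F \<Longrightarrow> finite (monomials F k)"
  by (simp add: monomials_def finite_PiE)

lemma card_monomials: "finite F \<Longrightarrow> card (monomials F k) \<le> (k + 1) ^ card F"
  unfolding monomials_def
  by (rule order.trans[OF card_image_le]) (simp_all add: finite_PiE card_PiE)

lemma monomialsI: "(\<And>c. c \<in> F \<Longrightarrow> e c \<le> k) \<Longrightarrow> (\<Prod>c\<in>F. c ^ e c) \<in> monomials F k"
  unfolding monomials_def
  by (rule image_eqI[where x = "restrict e F"]) (auto intro: prod.cong)

lemma monomials_mult:
  "x \<in> monomials F k \<Longrightarrow> y \<in> monomials F l \<Longrightarrow> x * y \<in> monomials F (k + l)"
  unfolding monomials_def[of F k] monomials_def[of F l]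
  by (auto simp: power_add[symmetric] prod.distrib[symmetric] PiE_iff
      intro!: monomialsI add_mono)

lemma monomials_mono: "k \<le> l \<Longrightarrow> monomials F k \<subseteq> monomials F l"
  unfolding monomials_def by (intro image_mono PiE_mono) auto

lemma bounded_polys_mono: "k \<le> l \<Longrightarrow> bounded_polys F k \<subseteq> bounded_polys F l"
  unfolding bounded_polys_def by (intro span_mono monomials_mono)

lemma bounded_polys_mult:
  assumes "x \<in> bounded_polys F k" "y \<in> bounded_polys F l"
  shows "x * y \<in> bounded_polys F (k + l)"
proof -
  let ?W = "bounded_polys F (k + l)"
  have mon: "m * y \<in> ?W" if m: "m \<in> monomials F k" for m
    using assms(2) unfolding bounded_polys_def[of F l]
  proof (induction rule: span_induct_alt)
    case base
    show ?case by (simp add: bounded_polys_def span_zero)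
  next
    case (step c z y)
    have "m * z \<in> ?W"
      using monomials_mult[OF m step(1)] by (simp add: bounded_polys_def span_base)
    then have "s c * (m * z) + m * y \<in> ?W"
      using step(2) unfolding bounded_polys_def by (intro span_add span_scale)
    then show ?case by (simp add: algebra_simps)
  qed
  show ?thesis
    using assms(1) unfolding bounded_polys_def[of F k]
  proof (induction rule: span_induct_alt)
    case base
    show ?case by (simp add: bounded_polys_def span_zero)
  next
    case (step c z x)
    have "s c * (z * y) + x * y \<in> ?W"
      using step(2) mon[OF step(1)] unfolding bounded_polys_def by (intro span_add span_scale)
    then show ?case by (simp add: algebra_simps)
  qed
qed

lemma scalar_bounded_polys: "s c \<in> bounded_polys F k"
proof -
  have "1 \<in> monomials F k"
    using monomialsI[of F "\<lambda>_. 0" k] by simp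
  then have "s c * 1 \<in> bounded_polys F k"
    unfolding bounded_polys_def by (intro span_scale span_base)
  then show ?thesis by simp
qed

lemma one_bounded_polys: "1 \<in> bounded_polys F k"
  using scalar_bounded_polys[of 1] by (simp add: s_one)

lemma gen_bounded_polys:
  assumes "finite F" "c \<in> F" shows "c \<in> bounded_polys F 1"
proof -
  have "(\<Prod>c'\<in>F. c' ^ (if c' = c then 1 else 0)) = c"
    using assms by (simp add: prod.remove)
  then show ?thesis
    using monomialsI[of F "\<lambda>c'. if c' = c then 1 else 0" 1]
    by (simp add: bounded_polys_def span_base)
qed

lemma bounded_polys_power: "x \<in> bounded_polys F k \<Longrightarrow> x ^ m \<in> bounded_polys F (m * k)"
  by (induction m) (auto intro: one_bounded_polys bounded_polys_mult)

lemma bounded_polys_prod: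
  "finite I \<Longrightarrow> (\<And>i. i \<in> I \<Longrightarrow> f i \<in> bounded_polys F k) \<Longrightarrow>
    prod f I \<in> bounded_polys F (card I * k)"
  by (induction I rule: finite_induct) (auto intro: one_bounded_polys bounded_polys_mult)

definition polys :: "'r set \<Rightarrow> 'r set" where
  "polys F = (\<Union>k. bounded_polys F k)"

lemma polysI: "x \<in> bounded_polys F k \<Longrightarrow> x \<in> polys F"
  by (auto simp: polys_def)

lemma subring_set_polys: "subring_set (polys F)"
proof
  show "1 \<in> polys F" by (rule polysI[OF one_bounded_polys])
next
  fix x y assume "x \<in> polys F" "y \<in> polys F"
  then obtain k l where kl: "x \<in> bounded_polys F k" "y \<in> bounded_polys F l"
    by (auto simp: polys_def)
  then show "x * y \<in> polys F" by (blast intro: polysI bounded_polys_mult)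
  have "x \<in> bounded_polys F (k + l)" "y \<in> bounded_polys F (k + l)"
    using kl bounded_polys_mono[of k "k + l"] bounded_polys_mono[of l "k + l"] by auto
  then show "x + y \<in> polys F"
    unfolding bounded_polys_def by (intro polysI[unfolded bounded_polys_def] span_add)
next
  fix x assume "x \<in> polys F"
  then show "- x \<in> polys F"
    unfolding polys_def bounded_polys_def using span_neg by blast
qed

subsection \<open>Elements that become polynomial after clearing denominators\<close>

text \<open>
  The part of the ambient domain that lies in the field of fractions of \<open>polys F\<close>.
\<close>
definition fractions :: "'r set \<Rightarrow> 'r set" where
  "fractions F = {x. \<exists>D\<in>polys F. D \<noteq> 0 \<and> D * x \<in> polys F}"

lemma polys_subset_fractions: "polys F \<subseteq> fractions F"
proof -
  interpret subring_set "polys F" by (rule subring_set_polys)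
  show ?thesis using one_mem by (auto simp: fractions_def intro!: bexI[of _ 1])
qed

lemma subring_set_fractions: "subring_set (fractions F)"
proof -
  interpret subring_set "polys F" by (rule subring_set_polys)
  show ?thesis
  proof
    show "1 \<in> fractions F" using polys_subset_fractions one_mem by auto
  next
    fix x assume "x \<in> fractions F"
    then show "- x \<in> fractions F"
      by (auto simp: fractions_def intro: uminus_mem)
  next
    fix x y assume "x \<in> fractions F" "y \<in> fractions F"
    then obtain D E where D: "D \<in> polys F" "D \<noteq> 0" "D * x \<in> polys F"
      and E: "E \<in> polys F" "E \<noteq> 0" "E * y \<in> polys F"
      by (auto simp: fractions_def)
    have "E * (D * x) + D * (E * y) \<in> polys F" "(D * x) * (E * y) \<in> polys F"
      using D E by (auto intro: add_mem mult_mem)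
    moreover have "E * (D * x) + D * (E * y) = D * E * (x + y)"
      "(D * x) * (E * y) = D * E * (x * y)"
      by (simp_all add: algebra_simps)
    ultimately have "D * E * (x + y) \<in> polys F" "D * E * (x * y) \<in> polys F"
      by metis+
    then show "x + y \<in> fractions F" "x * y \<in> fractions F"
      using D E unfolding fractions_def by (auto intro!: bexI[of _ "D * E"] mult_mem)
  qed
qed

text \<open>
  This is how a relation that is linear in \<open>x\<close>, with a nonzero leading coefficient \<open>m\<close>,
  expresses \<open>x\<close> through elements already known to be fractions.
\<close>
lemma fractions_divide:
  assumes "m \<in> fractions F" "m \<noteq> 0" "m * x \<in> fractions F"
  shows "x \<in> fractions F"
proof -
  interpret subring_set "polys F" by (rule subring_set_polys)
  obtain D E where D: "D \<in> polys F" "D \<noteq> 0" "D * m \<in> polys F"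
    and E: "E \<in> polys F" "E \<noteq> 0" "E * (m * x) \<in> polys F"
    using assms by (auto simp: fractions_def)
  have "E * (D * m) * x = D * (E * (m * x))" by (simp add: algebra_simps)
  then have "E * (D * m) * x \<in> polys F" using mult_mem[OF D(1) E(3)] by metis
  then show ?thesis
    using D E assms(2) unfolding fractions_def
    by (auto intro!: bexI[of _ "E * (D * m)"] mult_mem)
qed

lemma common_denominator:
  assumes "finite I" "\<And>i. i \<in> I \<Longrightarrow> x i \<in> fractions F"
  shows "\<exists>D\<in>polys F. D \<noteq> 0 \<and> (\<forall>i\<in>I. D * x i \<in> polys F)"
  using assms
proof (induction I rule: finite_induct)
  interpret subring_set "polys F" by (rule subring_set_polys)
  case empty
  show ?case using one_mem by (auto intro!: bexI[of _ 1])
next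
  interpret subring_set "polys F" by (rule subring_set_polys)
  case (insert j I)
  then obtain D where D: "D \<in> polys F" "D \<noteq> 0" "\<forall>i\<in>I. D * x i \<in> polys F" by auto
  obtain E where E: "E \<in> polys F" "E \<noteq> 0" "E * x j \<in> polys F"
    using insert.prems[of j] by (auto simp: fractions_def)
  have "D * E * x j \<in> polys F"
    using mult_mem[OF D(1) E(3)] by (simp add: mult.assoc)
  moreover have "D * E * x i \<in> polys F" if "i \<in> I" for i
    using mult_mem[OF E(1) D(3)[rule_format, OF that]] by (simp add: algebra_simps)
  ultimately show ?case
    using D E by (intro bexI[of _ "D * E"] mult_mem) auto
qed

lemma polys_common_bound:
  assumes "finite X" "X \<subseteq> polys F"
  shows "\<exists>k. X \<subseteq> bounded_polys F k"
  using assms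
proof (induction X rule: finite_induct)
  case (insert x X)
  then obtain k l where "X \<subseteq> bounded_polys F k" "x \<in> bounded_polys F l"
    by (auto simp: polys_def)
  then show ?case
    using bounded_polys_mono[of k "k + l" F] bounded_polys_mono[of l "k + l" F]
    by (intro exI[of _ "k + l"]) auto
qed simp

text \<open>
  Adjoining fractions does not raise the transcendence degree: after multiplication by a power of
  a common denominator \<open>D\<close>, the monomials in \<open>x 0, \<dots>, x d\<close> with exponents below \<open>k\<close> lie in a
  space spanned by polynomially many monomials of \<open>F\<close>, where the exponent of \<open>k\<close> is only
  \<open>d = card F\<close>. For large \<open>k\<close> there are too many of them to be independent.
\<close>
lemma fractions_dependent:
  assumes F: "finite F" and x: "\<And>i. i < Suc (card F) \<Longrightarrow> x i \<in> fractions F"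
  shows "\<exists>k u. (\<exists>e \<in> {0..<Suc (card F)} \<rightarrow>\<^sub>E {..<k}. u e \<noteq> 0) \<and>
    (\<Sum>e \<in> {0..<Suc (card F)} \<rightarrow>\<^sub>E {..<k}. s (u e) * (\<Prod>i\<in>{0..<Suc (card F)}. x i ^ e i)) = 0"
proof -
  define d where "d = card F"
  define n where "n = Suc d"
  obtain D where D: "D \<in> polys F" "D \<noteq> 0" "\<forall>i\<in>{0..<n}. D * x i \<in> polys F"
    using common_denominator[of "{0..<n}" x F] x by (auto simp: n_def d_def)
  obtain C where C: "insert D ((\<lambda>i. D * x i) ` {0..<n}) \<subseteq> bounded_polys F C"
    using polys_common_bound[of "insert D ((\<lambda>i. D * x i) ` {0..<n})" F] D by auto
  obtain k where k: "(n * C * k + 1) ^ d < k ^ n"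
    using power_count[of "n * C" d] unfolding n_def by blast
  define I where "I = ({0..<n} \<rightarrow>\<^sub>E {..<k})"
  define v where "v e = (\<Prod>i\<in>{0..<n}. D ^ k * x i ^ e i)" for e :: "nat \<Rightarrow> nat"
  have mem: "v e \<in> span (monomials F (n * C * k))" if e: "e \<in> I" for e
  proof -
    \<comment> \<open>Of the \<open>k\<close> factors \<open>D\<close>, each power of \<open>x i\<close> uses one; the others are kept as they are,
      so that all exponents need the same number of factors from the filtration step \<open>C\<close>.\<close>
    have "D ^ k * x i ^ e i \<in> bounded_polys F (k * C)" if i: "i \<in> {0..<n}" for i
    proof -
      have "e i < k" using e i by (auto simp: I_def)
      then have eq: "(k - e i) * C + e i * C = k * C" "k - e i + e i = k"
        by (simp_all add: add_mult_distrib[symmetric])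
      have "D ^ (k - e i) * (D * x i) ^ e i \<in> bounded_polys F ((k - e i) * C + e i * C)"
        using C i
        by (intro bounded_polys_mult bounded_polys_power) (simp_all add: image_subset_iff)
      moreover have "D ^ (k - e i) * (D * x i) ^ e i = D ^ k * x i ^ e i"
        unfolding power_mult_distrib mult.assoc[symmetric] power_add[symmetric] eq(2) ..
      ultimately show ?thesis using eq(1) by simp
    qed
    then have "v e \<in> bounded_polys F (card {0..<n} * (k * C))"
      unfolding v_def by (intro bounded_polys_prod) auto
    then show ?thesis by (simp add: bounded_polys_def algebra_simps)
  qed
  have "card (monomials F (n * C * k)) < card I"
    using card_monomials[OF F, of "n * C * k"] k by (simp add: I_def card_PiE d_def)
  then obtain u where u: "\<exists>e\<in>I. u e \<noteq> 0" "(\<Sum>e\<in>I. s (u e) * v e) = 0"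
    using family_dependent[of I "monomials F (n * C * k)" v] mem finite_monomials[OF F]
    by (auto simp: I_def finite_PiE)
  have "(\<Sum>e\<in>I. s (u e) * v e) =
      (D ^ k) ^ n * (\<Sum>e\<in>I. s (u e) * (\<Prod>i\<in>{0..<n}. x i ^ e i))"
    by (simp add: v_def prod.distrib sum_distrib_left mult.left_commute)
  then have "(\<Sum>e\<in>I. s (u e) * (\<Prod>i\<in>{0..<n}. x i ^ e i)) = 0"
    using u(2) D(2) by simp
  then show ?thesis
    using u(1) unfolding I_def n_def d_def by blast
qed

end

section \<open>Chains of prime ideals and algebraic independence\<close>

text \<open>
  The mechanism behind the independence of elements chosen along a chain of primes. The lowest
  coefficient \<open>G 0\<close> of a relation modulo \<open>p\<close> lies in \<open>p'\<close>, since \<open>x\<close> does; by assumption it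
  then vanishes, and \<open>x\<close> can be cancelled modulo the prime \<open>p\<close>.
\<close>
lemma (in subring_set) prime_step_coefficients_zero:
  assumes p: "primeideal p (ring_on A)" and p': "primeideal p' (ring_on A)" "p \<subseteq> p'"
    and x: "x \<in> p'" "x \<notin> p"
    and G: "\<And>t. t < k \<Longrightarrow> G t \<in> A" "\<And>t. t < k \<Longrightarrow> G t \<in> p' \<Longrightarrow> G t = 0"
    and sum: "(\<Sum>t<k. x ^ t * G t) \<in> p"
  shows "\<forall>t<k. G t = 0"
  using G sum
proof (induction k arbitrary: G)
  case (Suc k)
  note P = primeideal_ring_onD[OF p] and P' = primeideal_ring_onD[OF p'(1)]
  have xA: "x \<in> A" using x P'(1) by auto
  define H where "H = (\<Sum>t<k. x ^ t * G (Suc t))"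
  have HA: "H \<in> A"
    unfolding H_def by (intro sum_mem mult_mem power_mem xA Suc.prems) auto
  have eq: "(\<Sum>t<Suc k. x ^ t * G t) = G 0 + x * H"
    by (simp only: sum.lessThan_Suc_shift H_def) (simp add: sum_distrib_left mult.assoc)
  have xH: "x * H \<in> p'"
    using P'(5)[OF HA x(1)] by (simp add: mult.commute)
  have "(G 0 + x * H) + - (x * H) \<in> p'"
    using Suc.prems(3) p'(2) xH unfolding eq
    by (intro P'(4)[OF _ P'(6)]) auto
  then have G0: "G 0 = 0"
    using Suc.prems(2)[of 0] by simp
  then have "x * H \<in> p" using Suc.prems(3) unfolding eq by simp
  then have "H \<in> p" using P(7)[OF xA HA] x(2) by blast
  then have "\<forall>t<k. G (Suc t) = 0"
    using Suc.prems(1,2) unfolding H_def by (intro Suc.IH) auto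
  then show ?case using G0 by (auto simp: less_Suc_eq_0_disj)
qed simp

context field_algebra
begin

text \<open>
  If \<open>x i\<close> is in \<open>p (i + 1)\<close> but not in \<open>p i\<close>, then \<open>x l, \<dots>, x (n - 1)\<close> satisfy no polynomial
  relation modulo \<open>p l\<close>. Going down from \<open>l = n\<close>, where only constants are left and \<open>p n\<close> is a
  proper ideal, each step views a relation as a polynomial in \<open>x l\<close> whose coefficients are
  polynomials in the later elements.
\<close>
lemma chain_independent:
  fixes p :: "nat \<Rightarrow> 'r set" and u :: "(nat \<Rightarrow> nat) \<Rightarrow> 'k"
  assumes A: "subring_set A" and K: "range s \<subseteq> A"
    and prime: "\<And>i. i \<le> n \<Longrightarrow> primeideal (p i) (ring_on A)"
    and chain: "\<And>i. i < n \<Longrightarrow> p i \<subseteq> p (Suc i)"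
    and x: "\<And>i. i < n \<Longrightarrow> x i \<in> p (Suc i) - p i"
    and "l \<le> n"
    and "(\<Sum>e \<in> {l..<n} \<rightarrow>\<^sub>E {..<k}. s (u e) * (\<Prod>i\<in>{l..<n}. x i ^ e i)) \<in> p l"
  shows "\<forall>e \<in> {l..<n} \<rightarrow>\<^sub>E {..<k}. u e = 0"
  using \<open>l \<le> n\<close> assms(7)
proof (induction l arbitrary: u rule: inc_induct)
  interpret subring_set A by (rule A)
  case base
  have mem: "s (u (\<lambda>_. undefined)) \<in> p n"
    using base by (simp add: PiE_empty_domain)
  have "u (\<lambda>_. undefined) = 0"
  proof (rule ccontr)
    assume nz: "u (\<lambda>_. undefined) \<noteq> 0"
    have "s (inverse (u (\<lambda>_. undefined))) * s (u (\<lambda>_. undefined)) \<in> p n"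
      using mem K by (intro primeideal_ring_onD(5)[OF prime]) auto
    then have "1 \<in> p n"
      using nz by (simp add: s_mult[symmetric] s_one)
    then show False using primeideal_ring_onD(2)[OF prime] by auto
  qed
  then show ?case by (simp add: PiE_empty_domain)
next
  interpret subring_set A by (rule A)
  case (step l)
  have l: "l < n" by fact
  define J where "J = {Suc l..<n}"
  have lJ: "{l..<n} = insert l J" "l \<notin> J" "finite J" using l by (auto simp: J_def)
  have xA: "x i \<in> A" if "i < n" for i
    using x[OF that] primeideal_ring_onD(1)[OF prime[of "Suc i"]] that by auto
  define G where
    "G t = (\<Sum>e \<in> J \<rightarrow>\<^sub>E {..<k}. s (u (e(l := t))) * (\<Prod>i\<in>J. x i ^ e i))" for t
  have "(\<Sum>e \<in> {l..<n} \<rightarrow>\<^sub>E {..<k}. s (u e) * (\<Prod>i\<in>{l..<n}. x i ^ e i)) =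
      (\<Sum>t<k. x l ^ t * G t)"
  proof -
    have "(\<Prod>i\<in>J. x i ^ (if i = l then t else e i)) = (\<Prod>i\<in>J. x i ^ e i)" for t and e :: "nat \<Rightarrow> nat"
      using lJ(2) by (intro prod.cong) auto
    then show ?thesis
      unfolding lJ(1) G_def using lJ(2,3)
      by (simp add: sum_PiE_insert sum_distrib_left algebra_simps)
  qed
  then have sum: "(\<Sum>t<k. x l ^ t * G t) \<in> p l" using step by simp
  have GA: "G t \<in> A" for t
    unfolding G_def J_def using K xA
    by (intro sum_mem mult_mem prod_mem power_mem) auto
  have coeff: "\<forall>e \<in> J \<rightarrow>\<^sub>E {..<k}. u (e(l := t)) = 0" if "G t \<in> p (Suc l)" for t
    using step.IH[of "\<lambda>e. u (e(l := t))"] that unfolding G_def J_def by simp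
  have "G t = 0" if "G t \<in> p (Suc l)" for t
    using coeff[OF that] unfolding G_def by (simp add: s_zero)
  then have G0: "\<forall>t<k. G t = 0"
    using l x[OF l] sum GA chain[OF l]
    by (intro prime_step_coefficients_zero[of "p l" "p (Suc l)" "x l" k G] prime) auto
  show ?case
  proof
    fix e assume e: "e \<in> {l..<n} \<rightarrow>\<^sub>E {..<k}"
    have "restrict e J \<in> J \<rightarrow>\<^sub>E {..<k}" "e l < k"
      using e lJ(1) by auto
    moreover have "(restrict e J)(l := e l) = e"
      using e lJ by (auto simp: fun_eq_iff PiE_def extensional_def)
    moreover have "G (e l) \<in> p (Suc l)"
      using G0 \<open>e l < k\<close> primeideal_ring_onD(3)[OF prime[of "Suc l"]] l by simp
    ultimately show "u e = 0" using coeff[of "e l"] by metis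
  qed
qed

text \<open>
  The transcendence degree bounds the length of chains of primes: a chain of length \<open>card F + 1\<close>
  would give independent elements, which \<open>fractions_dependent\<close> excludes.
\<close>
lemma chain_length_le:
  assumes A: "subring_set A" and K: "range s \<subseteq> A"
    and F: "finite F" "A \<subseteq> fractions F"
    and prime: "\<And>i. i \<le> n \<Longrightarrow> primeideal (p i) (ring_on A)"
    and chain: "\<And>i. i < n \<Longrightarrow> p i \<subset> p (Suc i)"
  shows "n \<le> card F"
proof (rule ccontr)
  assume "\<not> n \<le> card F"
  then have n: "Suc (card F) \<le> n" by simp
  interpret subring_set A by (rule A)
  let ?n = "Suc (card F)"
  have "\<exists>y. y \<in> p (Suc i) - p i" if "i < n" for i
    using chain[OF that] by blast
  then obtain x where x: "\<And>i. i < n \<Longrightarrow> x i \<in> p (Suc i) - p i"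
    by metis
  have xF: "x i \<in> fractions F" if "i < ?n" for i
  proof -
    have "i < n" "Suc i \<le> n" using that n by auto
    then show ?thesis
      using x primeideal_ring_onD(1)[OF prime[of "Suc i"]] F(2) by blast
  qed
  obtain k u where u: "\<exists>e \<in> {0..<?n} \<rightarrow>\<^sub>E {..<k}. u e \<noteq> 0"
    "(\<Sum>e \<in> {0..<?n} \<rightarrow>\<^sub>E {..<k}. s (u e) * (\<Prod>i\<in>{0..<?n}. x i ^ e i)) = 0"
    using fractions_dependent[of F x, OF F(1) xF] by blast
  have "\<forall>e \<in> {0..<?n} \<rightarrow>\<^sub>E {..<k}. u e = 0"
  proof (rule chain_independent[OF A K, where p = p and x = x])
    show "(\<Sum>e \<in> {0..<?n} \<rightarrow>\<^sub>E {..<k}. s (u e) * (\<Prod>i\<in>{0..<?n}. x i ^ e i)) \<in> p 0"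
      unfolding u(2) by (rule primeideal_ring_onD(3)[OF prime]) simp
    show "p i \<subseteq> p (Suc i)" if "i < ?n" for i
      using chain[of i] that n by auto
  qed (use n x prime in auto)
  then show False using u(1) by blast
qed

end

section \<open>Ideals generated by variables\<close>

text \<open>
  An injection into the integers orders the variables linearly. The induced lexicographic order on
  monomials is compatible with their multiplication, so leading monomials multiply and the
  polynomial ring is a domain.
\<close>
fun var_code :: "edge_var \<Rightarrow> int" where
  "var_code (XV i) = 4 * i"
| "var_code (PV j) = 4 * j + 1"
| "var_code (QV i) = 4 * i + 2"
| "var_code (YV j) = 4 * j + 3"

lemma inj_var_code: "inj var_code"
proof (rule injI)
  show "v = w" if "var_code v = var_code w" for v w
    using that by (cases v; cases w; simp; presburger)
qed

instantiation edge_var :: linorder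
begin

definition less_eq_edge_var :: "edge_var \<Rightarrow> edge_var \<Rightarrow> bool" where
  "v \<le> w \<longleftrightarrow> var_code v \<le> var_code w"

definition less_edge_var :: "edge_var \<Rightarrow> edge_var \<Rightarrow> bool" where
  "v < w \<longleftrightarrow> var_code v < var_code w"

instance
  by standard (auto simp: less_eq_edge_var_def less_edge_var_def dest: injD[OF inj_var_code])

end

lemma keys_add_monomial:
  fixes m n :: "'v \<Rightarrow>\<^sub>0 nat"
  shows "Poly_Mapping.keys (m + n) = Poly_Mapping.keys m \<union> Poly_Mapping.keys n"
  by (auto simp: in_keys_iff lookup_add)

text \<open>
  The ideal generated by the variables in \<open>V\<close>, i.e. the polynomials that vanish when these
  variables are set to zero.
\<close>
definition var_ideal :: "edge_var set \<Rightarrow> 'k::field edge_poly set" where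
  "var_ideal V = {f. \<forall>m \<in> Poly_Mapping.keys f. Poly_Mapping.keys m \<inter> V \<noteq> {}}"

lemma var_ideal_mono: "V \<subseteq> W \<Longrightarrow> var_ideal V \<subseteq> var_ideal W"
  unfolding var_ideal_def by blast

lemma var_ideal_zero: "0 \<in> var_ideal V"
  by (simp add: var_ideal_def)

lemma var_ideal_one: "1 \<notin> var_ideal V"
  by (simp add: var_ideal_def)

lemma var_ideal_add: "f \<in> var_ideal V \<Longrightarrow> g \<in> var_ideal V \<Longrightarrow> f + g \<in> var_ideal V"
  using keys_add[of f g] unfolding var_ideal_def by blast

lemma var_ideal_uminus: "f \<in> var_ideal V \<Longrightarrow> - f \<in> var_ideal V"
  unfolding var_ideal_def by simp

lemma var_ideal_mult: "g \<in> var_ideal V \<Longrightarrow> f * g \<in> var_ideal V"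
  using keys_mult[of f g] unfolding var_ideal_def by (fastforce simp: keys_add_monomial)

lemma split_by_monomials:
  fixes f :: "'k::field edge_poly"
  obtains g h where "f = g + h" "g \<in> var_ideal V"
    "\<And>m. m \<in> Poly_Mapping.keys h \<Longrightarrow> Poly_Mapping.keys m \<inter> V = {}"
proof -
  define part where "part M = (\<Sum>m\<in>M. Poly_Mapping.single m (Poly_Mapping.lookup f m))" for M
  have keys: "Poly_Mapping.keys (part M) \<subseteq> M" if "finite M" for M
    unfolding part_def by (rule order.trans[OF keys_sum]) auto
  let ?N = "{m \<in> Poly_Mapping.keys f. Poly_Mapping.keys m \<inter> V \<noteq> {}}"
  have "part (Poly_Mapping.keys f) = f"
    by (rule poly_mapping_eqI)
      (auto simp: part_def lookup_sum lookup_single when_def in_keys_iff)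
  moreover have "part (Poly_Mapping.keys f) = part ?N + part (Poly_Mapping.keys f - ?N)"
    unfolding part_def by (subst sum.subset_diff[of ?N]) (auto simp: add.commute)
  ultimately have "f = part ?N + part (Poly_Mapping.keys f - ?N)"
    by simp
  moreover have "part ?N \<in> var_ideal V"
    using keys[of ?N] by (auto simp: var_ideal_def)
  moreover have "Poly_Mapping.keys m \<inter> V = {}"
    if "m \<in> Poly_Mapping.keys (part (Poly_Mapping.keys f - ?N))" for m
    using keys[of "Poly_Mapping.keys f - ?N"] that by auto
  ultimately show thesis by (rule that)
qed

text \<open>
  Discarding all monomials that contain a variable from \<open>V\<close> leaves polynomials \<open>f0\<close> and \<open>g0\<close>
  in the other variables. If both are nonzero, so is their product, and it still avoids \<open>V\<close>.
\<close>
lemma var_ideal_prime: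
  fixes f g :: "'k::field edge_poly"
  assumes "f * g \<in> var_ideal V"
  shows "f \<in> var_ideal V \<or> g \<in> var_ideal V"
proof (rule ccontr)
  assume neg: "\<not> ?thesis"
  obtain f1 f0 where f: "f = f1 + f0" "f1 \<in> var_ideal V"
    "\<And>m. m \<in> Poly_Mapping.keys f0 \<Longrightarrow> Poly_Mapping.keys m \<inter> V = {}"
    using split_by_monomials[of f V] by metis
  obtain g1 g0 where g: "g = g1 + g0" "g1 \<in> var_ideal V"
    "\<And>m. m \<in> Poly_Mapping.keys g0 \<Longrightarrow> Poly_Mapping.keys m \<inter> V = {}"
    using split_by_monomials[of g V] by metis
  have "f0 \<noteq> 0" "g0 \<noteq> 0" using neg f g by auto
  then have nz: "f0 * g0 \<noteq> 0" by simp
  have "f0 * g0 = f * g + - (f0 * g1 + g * f1)"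
    unfolding f(1) g(1) by (simp add: algebra_simps)
  also have "\<dots> \<in> var_ideal V"
    by (intro var_ideal_add var_ideal_uminus var_ideal_mult assms f(2) g(2))
  finally have mem: "f0 * g0 \<in> var_ideal V" .
  from nz obtain m where m: "m \<in> Poly_Mapping.keys (f0 * g0)"
    by (auto simp flip: keys_eq_empty)
  then obtain m1 m2 where "m = m1 + m2" "m1 \<in> Poly_Mapping.keys f0" "m2 \<in> Poly_Mapping.keys g0"
    using keys_mult[of f0 g0] by blast
  then have "Poly_Mapping.keys m \<inter> V = {}"
    using f(3) g(3) by (auto simp: keys_add_monomial)
  then show False using mem m by (auto simp: var_ideal_def)
qed

lemma primeideal_var_ideal:
  fixes A :: "'k::field edge_poly set"
  assumes "subring_set A"
  shows "primeideal (A \<inter> var_ideal V) (ring_on A)"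
proof -
  interpret subring_set A by fact
  show ?thesis
    by (rule primeideal_ring_onI)
      (use var_ideal_prime in \<open>auto intro: zero_mem add_mem mult_mem var_ideal_zero
        var_ideal_add var_ideal_mult simp: var_ideal_one\<close>)
qed

text \<open>
  Raising the threshold \<open>s\<close> shrinks the set of variables of weight at least \<open>s\<close>, hence also the
  prime ideal which they cut out on \<open>A\<close>. If some element of \<open>A\<close> leaves these primes exactly
  when \<open>s\<close> passes \<open>t\<close>, then the primes change there, so every such \<open>t\<close> adds a step to a chain.
\<close>
lemma card_le_krull_dim:
  fixes A :: "'k::field edge_poly set" and w :: "edge_var \<Rightarrow> int"
  assumes A: "subring_set A" and C: "finite C"
    and wit: "\<And>t. t \<in> C \<Longrightarrow>
      \<exists>f\<in>A. \<forall>s. f \<in> var_ideal {v. s \<le> w v} \<longleftrightarrow> s \<le> t"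
  shows "enat (card C) \<le> krull_dim (ring_on A)"
proof -
  obtain m where m: "\<forall>t\<in>C. t < m"
    using C by (metis Max_ge zle_iff_zadd less_add_one order.strict_trans1 order_le_less_trans)
  \<comment> \<open>A threshold \<open>m\<close> above all of \<open>C\<close> provides the smallest prime, so that \<open>card C\<close> steps
    come from \<open>card C + 1\<close> primes.\<close>
  define xs where "xs = sorted_list_of_set (insert m C)"
  have len: "length xs = Suc (card C)"
    using C m by (auto simp: xs_def)
  have sorted: "sorted_wrt (<) xs"
    unfolding xs_def by (rule strict_sorted_list_of_set)
  have set: "set xs = insert m C"
    unfolding xs_def using C by (intro set_sorted_list_of_set) simp
  define thr where "thr k = xs ! (card C - k)" for k
  define p where "p k = A \<inter> var_ideal {v. thr k \<le> w v}" for k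
  have less: "thr (Suc k) < thr k" if "k < card C" for k
    unfolding thr_def using that len by (intro sorted_wrt_nth_less[OF sorted]) auto
  have mem: "thr k \<in> insert m C" for k
    using set nth_mem[of "card C - k" xs] len by (simp add: thr_def)
  have strict: "p k \<subset> p (Suc k)" if k: "k < card C" for k
  proof -
    have "thr (Suc k) \<in> C"
      using mem[of "Suc k"] mem[of k] less[OF k] m by auto
    then obtain f where "f \<in> A" "\<forall>s. f \<in> var_ideal {v. s \<le> w v} \<longleftrightarrow> s \<le> thr (Suc k)"
      using wit by blast
    then have "f \<in> p (Suc k) - p k" using less[OF k] by (auto simp: p_def)
    moreover have "p k \<subseteq> p (Suc k)"
      unfolding p_def using less[OF k] by (intro Int_mono var_ideal_mono) auto
    ultimately show ?thesis by blast
  qed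
  have "primeideal (p k) (ring_on A)" for k
    unfolding p_def by (rule primeideal_var_ideal[OF A])
  then have "\<exists>p. (\<forall>i\<le>card C. primeideal (p i) (ring_on A)) \<and> (\<forall>i<card C. p i \<subset> p (Suc i))"
    using strict by (intro exI[of _ p]) simp
  then show ?thesis
    unfolding krull_dim_def by (intro Sup_upper) simp
qed

text \<open>
  The two terms cannot cancel, since \<open>x\<close> occurs in only one of them.
\<close>
lemma keys_binomial:
  assumes "x \<noteq> p" "x \<noteq> q"
  shows "Poly_Mapping.keys (Var x * Var y - Var p * Var q :: 'k::field edge_poly) =
    {Poly_Mapping.single x 1 + Poly_Mapping.single y 1,
     Poly_Mapping.single p 1 + Poly_Mapping.single q 1}"
proof -
  define m n :: "edge_var \<Rightarrow>\<^sub>0 nat" where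
    "m = Poly_Mapping.single x 1 + Poly_Mapping.single y 1" and
    "n = Poly_Mapping.single p 1 + Poly_Mapping.single q 1"
  have "Poly_Mapping.lookup m x \<noteq> Poly_Mapping.lookup n x"
    using assms by (simp add: m_def n_def lookup_add lookup_single)
  then have "m \<noteq> n" by auto
  moreover have "Var x * Var y - Var p * Var q =
      Poly_Mapping.single m 1 - (Poly_Mapping.single n 1 :: 'k edge_poly)"
    by (simp add: Var_def mult_single m_def n_def)
  ultimately show ?thesis
    unfolding m_def[symmetric] n_def[symmetric]
    by (auto simp: in_keys_iff lookup_minus lookup_single when_def split: if_splits)
qed

definition cell_binomial :: "int \<Rightarrow> int \<Rightarrow> 'k::field edge_poly" where
  "cell_binomial i j = Var (XV i) * Var (YV j) - Var (PV j) * Var (QV i)"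

lemma cell_binomial_in_var_ideal_iff:
  "cell_binomial i j \<in> var_ideal V \<longleftrightarrow>
    (XV i \<in> V \<or> YV j \<in> V) \<and> (PV j \<in> V \<or> QV i \<in> V)"
  by (auto simp: cell_binomial_def var_ideal_def keys_binomial keys_add_monomial)

text \<open>
  Setting to zero all variables of weight at least \<open>s\<close> kills a term iff \<open>s\<close> is at most the
  larger weight of its two factors, and it kills the binomial iff it kills both terms.
\<close>
definition cell_weight :: "(edge_var \<Rightarrow> int) \<Rightarrow> int \<Rightarrow> int \<Rightarrow> int" where
  "cell_weight w i j = min (max (w (XV i)) (w (YV j))) (max (w (PV j)) (w (QV i)))"

lemma cell_binomial_in_threshold_ideal_iff:
  "cell_binomial i j \<in> var_ideal {v. s \<le> w v} \<longleftrightarrow> s \<le> cell_weight w i j"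
  by (auto simp: cell_binomial_in_var_ideal_iff cell_weight_def)

section \<open>The two northwestern layers of a skew diagram\<close>

text \<open>
  If \<open>\<Gamma>\<close> meets every diagonal in a contiguous segment, these are the cells that are the first or
  the second one on their diagonal.
\<close>
definition NW_layers :: "(int \<times> int) set \<Rightarrow> (int \<times> int) set" where
  "NW_layers \<Gamma> = {(i, j) \<in> \<Gamma>. (i - 2, j - 2) \<notin> \<Gamma>}"

text \<open>
  The conditions on the rows that make the diagram convex (lemma \<open>rectangle_in_diagram\<close>) and
  keep it inside the \<open>a\<close> by \<open>b\<close> rectangle.
\<close>
locale skew_shape =
  fixes a b :: int and lam mu :: "int \<Rightarrow> int"
  assumes mu_nonneg: "\<And>i. 1 \<le> i \<Longrightarrow> i \<le> a \<Longrightarrow> 0 \<le> mu i"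
    and lam_step: "\<And>i. 1 \<le> i \<Longrightarrow> i < a \<Longrightarrow> lam (i + 1) \<le> lam i"
    and mu_step: "\<And>i. 1 \<le> i \<Longrightarrow> i < a \<Longrightarrow> mu (i + 1) \<le> mu i"
    and b_eq: "b = lam 1"
begin

abbreviation \<Gamma> :: "(int \<times> int) set" where
  "\<Gamma> \<equiv> skew_diagram a lam mu"

lemma mem_iff: "(i, j) \<in> \<Gamma> \<longleftrightarrow> 1 \<le> i \<and> i \<le> a \<and> mu i < j \<and> j \<le> lam i"
  by (simp add: skew_diagram_def)

lemma antimono:
  assumes "1 \<le> i" "i \<le> k" "k \<le> a"
  shows "lam k \<le> lam i" "mu k \<le> mu i"
proof -
  have "k \<le> a \<longrightarrow> lam k \<le> lam i \<and> mu k \<le> mu i"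
    using assms(2)
  proof (induction k rule: int_ge_induct)
    case (step k)
    then show ?case using assms(1) lam_step[of k] mu_step[of k] by auto
  qed simp
  then show "lam k \<le> lam i" "mu k \<le> mu i" using assms(3) by auto
qed

lemma cell_bounds:
  assumes "(i, j) \<in> \<Gamma>"
  shows "1 \<le> i" "i \<le> a" "1 \<le> j" "j \<le> b"
  using assms mu_nonneg[of i] antimono(1)[of 1 i] by (auto simp: mem_iff b_eq)

lemma finite_diagram: "finite \<Gamma>"
  by (rule finite_subset[of _ "{1..a} \<times> {1..b}"]) (use cell_bounds in auto)

text \<open>
  In particular \<open>\<Gamma>\<close> meets each diagonal in a contiguous segment.
\<close>
lemma rectangle_in_diagram:
  assumes "(i, j) \<in> \<Gamma>" "(i', j') \<in> \<Gamma>" "i \<le> k" "k \<le> i'" "j \<le> l" "l \<le> j'"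
  shows "(k, l) \<in> \<Gamma>"
  using assms antimono(2)[of i k] antimono(1)[of k i'] by (auto simp: mem_iff)

subsection \<open>Counting perimeter cells along diagonals\<close>

definition second_layer :: "(int \<times> int) set" where
  "second_layer = {(i, j) \<in> \<Gamma>. (i - 1, j - 1) \<in> \<Gamma> \<and> (i - 2, j - 2) \<notin> \<Gamma>}"

lemma NW_layers_eq: "NW_layers \<Gamma> = NW_perimeter \<Gamma> \<union> second_layer"
proof -
  have "(i - 1, j - 1) \<in> \<Gamma>" if "(i, j) \<in> \<Gamma>" "(i - 2, j - 2) \<in> \<Gamma>" for i j
    by (rule rectangle_in_diagram[OF that(2,1)]) auto
  then show ?thesis by (auto simp: NW_layers_def NW_perimeter_def second_layer_def)
qed

lemma inj_on_diagonalI: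
  fixes X :: "(int \<times> int) set"
  assumes "\<And>i j k. (i, j) \<in> X \<Longrightarrow> (i + k, j + k) \<in> X \<Longrightarrow> 1 \<le> k \<Longrightarrow> False"
  shows "inj_on (\<lambda>(i, j). i - j) X"
proof (rule inj_onI, clarify)
  fix i j i' j' assume X: "(i, j) \<in> X" "(i', j') \<in> X" and eq: "i - j = i' - j'"
  have j: "j + (i' - i) = j'" "j' + (i - i') = j"
    using eq by auto
  have "\<not> 1 \<le> i' - i" using assms[of i j "i' - i"] X j by auto
  moreover have "\<not> 1 \<le> i - i'" using assms[of i' j' "i - i'"] X j by auto
  ultimately show "i = i' \<and> j = j'" using eq by auto
qed

lemma inj_on_NW: "inj_on (\<lambda>(i, j). i - j) (NW_perimeter \<Gamma>)"
proof (rule inj_on_diagonalI)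
  fix i j k :: int
  assume *: "(i, j) \<in> NW_perimeter \<Gamma>" "(i + k, j + k) \<in> NW_perimeter \<Gamma>" "1 \<le> k"
  then have "(i + k - 1, j + k - 1) \<in> \<Gamma>"
    using rectangle_in_diagram[of i j "i + k" "j + k"] by (auto simp: NW_perimeter_def)
  then show False using * by (auto simp: NW_perimeter_def)
qed

lemma inj_on_second_layer: "inj_on (\<lambda>(i, j). i - j) second_layer"
proof (rule inj_on_diagonalI)
  fix i j k :: int
  assume *: "(i, j) \<in> second_layer" "(i + k, j + k) \<in> second_layer" "1 \<le> k"
  then have "(i + k - 2, j + k - 2) \<in> \<Gamma>"
    using rectangle_in_diagram[of "i - 1" "j - 1" "i + k" "j + k"]
    by (auto simp: second_layer_def)
  then show False using * by (auto simp: second_layer_def)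
qed

lemma inj_on_SE: "inj_on (\<lambda>(i, j). i - j) (SE_perimeter \<Gamma>)"
proof (rule inj_on_diagonalI)
  fix i j k :: int
  assume *: "(i, j) \<in> SE_perimeter \<Gamma>" "(i + k, j + k) \<in> SE_perimeter \<Gamma>" "1 \<le> k"
  then have "(i + 1, j + 1) \<in> \<Gamma>"
    using rectangle_in_diagram[of i j "i + k" "j + k"] by (auto simp: SE_perimeter_def)
  then show False using * by (auto simp: SE_perimeter_def)
qed

lemma diagonal_descend:
  assumes "(i, j) \<in> \<Gamma>" "(i - 1, j - 1) \<in> \<Gamma>"
  shows "\<exists>k. (i - k, j - k) \<in> second_layer"
  using assms
proof (induction "nat i" arbitrary: i j rule: less_induct)
  case less
  show ?case
  proof (cases "(i - 2, j - 2) \<in> \<Gamma>")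
    case True
    have "\<exists>k. ((i - 1) - k, (j - 1) - k) \<in> second_layer"
      using less.prems True cell_bounds[OF less.prems(1)] by (intro less.hyps) auto
    then obtain k where "((i - 1) - k, (j - 1) - k) \<in> second_layer" ..
    then show ?thesis by (intro exI[of _ "k + 1"]) (simp add: algebra_simps)
  next
    case False
    then show ?thesis using less.prems by (intro exI[of _ 0]) (simp add: second_layer_def)
  qed
qed

lemma diagonal_ascend:
  assumes "(i, j) \<in> \<Gamma>" "(i - 1, j - 1) \<in> \<Gamma>"
  shows "\<exists>k. (i + k, j + k) \<in> SE_perimeter \<Gamma>"
  using assms
proof (induction "nat (a - i)" arbitrary: i j rule: less_induct)
  case less
  show ?case
  proof (cases "(i + 1, j + 1) \<in> \<Gamma>")
    case True
    have "\<exists>k. ((i + 1) + k, (j + 1) + k) \<in> SE_perimeter \<Gamma>"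
      using less.prems True cell_bounds[OF True] by (intro less.hyps) auto
    then obtain k where "((i + 1) + k, (j + 1) + k) \<in> SE_perimeter \<Gamma>" ..
    then show ?thesis by (intro exI[of _ "k + 1"]) (simp add: algebra_simps)
  next
    case False
    then show ?thesis using less.prems by (intro exI[of _ 0]) (simp add: SE_perimeter_def)
  qed
qed

text \<open>
  Both sets select one cell from each diagonal with at least two cells of \<open>\<Gamma>\<close>: the second one and
  the last one.
\<close>
lemma card_second_layer: "card second_layer = card (SE_perimeter \<Gamma>)"
proof -
  have "(\<lambda>(i, j). i - j) ` second_layer = (\<lambda>(i, j). i - j) ` SE_perimeter \<Gamma>" (is "?d ` _ = _")
  proof (intro equalityI image_subsetI)
    fix c assume "c \<in> second_layer"
    then obtain i j where c: "c = (i, j)" "(i, j) \<in> \<Gamma>" "(i - 1, j - 1) \<in> \<Gamma>"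
      by (auto simp: second_layer_def)
    then obtain k where "(i + k, j + k) \<in> SE_perimeter \<Gamma>"
      using diagonal_ascend by blast
    then show "?d c \<in> ?d ` SE_perimeter \<Gamma>" using c(1) by force
  next
    fix c assume "c \<in> SE_perimeter \<Gamma>"
    then obtain i j where c: "c = (i, j)" "(i, j) \<in> \<Gamma>" "(i - 1, j - 1) \<in> \<Gamma>"
      by (auto simp: SE_perimeter_def)
    then obtain k where "(i - k, j - k) \<in> second_layer"
      using diagonal_descend by blast
    then show "?d c \<in> ?d ` second_layer" using c(1) by force
  qed
  then show ?thesis
    using card_image[OF inj_on_second_layer] card_image[OF inj_on_SE] by metis
qed

lemma card_NW_layers: "card (NW_layers \<Gamma>) = card (NW_perimeter \<Gamma> \<union> SE_perimeter \<Gamma>)"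
proof -
  have fin: "finite (NW_perimeter \<Gamma>)" "finite second_layer" "finite (SE_perimeter \<Gamma>)"
    using finite_diagram
    by (auto intro: finite_subset simp: NW_perimeter_def SE_perimeter_def second_layer_def)
  have "NW_perimeter \<Gamma> \<inter> second_layer = {}"
    by (auto simp: NW_perimeter_def second_layer_def)
  then show ?thesis
    using fin perimeter_disjoint[of \<Gamma>]
    by (simp add: NW_layers_eq card_Un_disjoint card_second_layer)
qed

subsection \<open>Weights separating the cells of the two layers\<close>

text \<open>
  Rows above the diagram count as removed completely. With this convention the description of the
  layers needs no exception for the first two rows.
\<close>
definition mu_ext :: "int \<Rightarrow> int" where
  "mu_ext i = (if i \<le> 0 then b else mu i)"

text \<open>
  The first row that meets column \<open>j\<close> to the right of \<open>\<mu>\<close> (see \<open>top_row_le_iff\<close>). As \<open>\<mu>\<close> is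
  decreasing, the rows above it are those with \<open>j \<le> mu i\<close>; counting them also gives a value larger
  than \<open>a\<close> when there is no such row, which is what column \<open>0\<close> requires.
\<close>
definition top_row :: "int \<Rightarrow> int" where
  "top_row j = 1 + int (card {i \<in> {1..a}. j \<le> mu i})"

lemma top_row_le_iff:
  assumes "1 \<le> i" "i \<le> a"
  shows "top_row j \<le> i \<longleftrightarrow> mu i < j"
proof
  assume *: "mu i < j"
  have "{k \<in> {1..a}. j \<le> mu k} \<subseteq> {1..i - 1}"
  proof clarify
    fix k assume k: "k \<in> {1..a}" "j \<le> mu k"
    have "\<not> i \<le> k" using antimono(2)[of i k] assms k * by auto
    then show "k \<in> {1..i - 1}" using k by auto
  qed
  then have "card {k \<in> {1..a}. j \<le> mu k} \<le> card {1..i - 1}"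
    by (intro card_mono) auto
  then show "top_row j \<le> i" using assms by (simp add: top_row_def)
next
  assume *: "top_row j \<le> i"
  show "mu i < j"
  proof (rule ccontr)
    assume "\<not> mu i < j"
    then have "{1..i} \<subseteq> {k \<in> {1..a}. j \<le> mu k}"
      using antimono(2)[of _ i] assms by force
    then have "card {1..i} \<le> card {k \<in> {1..a}. j \<le> mu k}"
      by (rule card_mono[OF finite_subset[of _ "{1..a}"], rotated -1]) auto
    then show False using * assms by (simp add: top_row_def)
  qed
qed

lemma top_row_pos: "1 \<le> top_row j"
  by (simp add: top_row_def)

text \<open>
  Walk along the northwestern layer from northeast to southwest. In each step \<open>i - j\<close> grows by one,
  and the new cell brings in at most one row or column that was not met before: row \<open>i\<close> is entered
  at column \<open>mu (i - 1) + 1\<close>, and column \<open>j\<close> at row \<open>top_row j\<close>. Giving \<open>x\<close> and \<open>y\<close> twice the value of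
  \<open>i - j\<close> at the cell where the row or column enters makes the larger of the two weights equal to
  \<open>2 * (i - j)\<close> along the whole walk.

  The second layer is the northwestern layer of the diagram formed by the cells \<open>(i, j)\<close> with
  \<open>(i - 1, j - 1)\<close> in \<open>\<Gamma>\<close>, where \<open>mu i\<close> is replaced by \<open>mu (i - 1) + 1\<close>. The same recipe for this
  diagram gives the weights of \<open>q\<close> and \<open>p\<close>; the extra \<open>1\<close> separates the two layers by parity.
\<close>
fun layer_weight :: "edge_var \<Rightarrow> int" where
  "layer_weight (XV i) = 2 * (i - mu_ext (i - 1) - 1)"
| "layer_weight (YV j) = 2 * (top_row j - j)"
| "layer_weight (QV i) = 2 * (i - mu_ext (i - 2) - 2) + 1"
| "layer_weight (PV j) = 2 * (top_row (j - 1) + 1 - j) + 1"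

lemma diagonal_shift_iff:
  assumes "(i, j) \<in> \<Gamma>" "0 \<le> k"
  shows "(i - k, j - k) \<in> \<Gamma> \<longleftrightarrow> mu_ext (i - k) < j - k"
  using assms cell_bounds[OF assms(1)] antimono(1)[of "i - k" i]
  by (auto simp: mem_iff mu_ext_def)

text \<open>
  The term in \<open>x\<close> and \<open>y\<close> has the weight claimed, and the other term a larger one: a cell of the
  northwestern layer lies above all cells of its column in the shifted diagram, so the weight of
  \<open>PV j\<close> exceeds \<open>2 * (i - j)\<close>.
\<close>
lemma cell_weight_NW:
  assumes "(i, j) \<in> NW_perimeter \<Gamma>"
  shows "cell_weight layer_weight i j = 2 * (i - j)"
proof -
  have c: "(i, j) \<in> \<Gamma>" "j \<le> mu_ext (i - 1) + 1"
    using assms diagonal_shift_iff[of i j 1] by (auto simp: NW_perimeter_def)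
  note bd = cell_bounds[OF c(1)]
  have "top_row j \<le> i"
    using c bd by (simp add: top_row_le_iff mem_iff)
  moreover have "i \<le> top_row j" if "j \<le> mu_ext (i - 1)"
    using top_row_le_iff[of "i - 1" j] top_row_pos[of j] that bd
    by (cases "i = 1") (auto simp: mu_ext_def)
  moreover have "i \<le> top_row (j - 1)"
    using top_row_le_iff[of "i - 1" "j - 1"] top_row_pos[of "j - 1"] c(2) bd
    by (cases "i = 1") (auto simp: mu_ext_def)
  ultimately show ?thesis
    using c(2) unfolding cell_weight_def layer_weight.simps
    by (cases "j = mu_ext (i - 1) + 1") (auto simp: min_def max_def)
qed

text \<open>
  Now the term in \<open>p\<close> and \<open>q\<close> is the smaller one: its row was entered by the northwestern layer
  at a column left of \<open>j\<close>, so the weight of \<open>XV i\<close> exceeds \<open>2 * (i - j) + 1\<close>.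
\<close>
lemma cell_weight_second_layer:
  assumes "(i, j) \<in> second_layer"
  shows "cell_weight layer_weight i j = 2 * (i - j) + 1"
proof -
  have c: "(i, j) \<in> \<Gamma>" "mu_ext (i - 1) + 1 < j" "j \<le> mu_ext (i - 2) + 2"
    using assms diagonal_shift_iff[of i j 1] diagonal_shift_iff[of i j 2]
    by (auto simp: second_layer_def)
  note bd = cell_bounds[OF c(1)]
  have i: "2 \<le> i" using c(2) bd by (auto simp: mu_ext_def split: if_splits)
  have "top_row (j - 1) \<le> i - 1"
    using top_row_le_iff[of "i - 1" "j - 1"] c(2) i bd by (auto simp: mu_ext_def)
  moreover have "i - 1 \<le> top_row (j - 1)" if "j - 1 \<le> mu_ext (i - 2)"
    using top_row_le_iff[of "i - 2" "j - 1"] top_row_pos[of "j - 1"] that i bd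
    by (cases "i = 2") (auto simp: mu_ext_def)
  ultimately show ?thesis
    using c(2,3) unfolding cell_weight_def layer_weight.simps
    by (cases "j = mu_ext (i - 2) + 2") (auto simp: min_def max_def)
qed

lemma inj_on_cell_weight:
  "inj_on (\<lambda>(i, j). cell_weight layer_weight i j) (NW_layers \<Gamma>)"
proof (rule inj_onI, clarify)
  fix i j i' j'
  assume c: "(i, j) \<in> NW_layers \<Gamma>" "(i', j') \<in> NW_layers \<Gamma>"
    and eq: "cell_weight layer_weight i j = cell_weight layer_weight i' j'"
  note cell_weight_NW[simp] cell_weight_second_layer[simp]
  consider "(i, j) \<in> NW_perimeter \<Gamma>" "(i', j') \<in> NW_perimeter \<Gamma>" "i - j = i' - j'"
    | "(i, j) \<in> second_layer" "(i', j') \<in> second_layer" "i - j = i' - j'"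
    using c eq unfolding NW_layers_eq by (auto; presburger)
  then have "(i, j) = (i', j')"
  proof cases
    case 1
    show ?thesis by (rule inj_onD[OF inj_on_NW _ 1(1,2)]) (use 1(3) in simp)
  next
    case 2
    show ?thesis by (rule inj_onD[OF inj_on_second_layer _ 2(1,2)]) (use 2(3) in simp)
  qed
  then show "i = i' \<and> j = j'" by simp
qed

end

section \<open>Vanishing minors and the Krull dimension\<close>

text \<open>
  The vanishing of a 3 by 3 minor of the matrix \<open>c\<close>, which is a product of two matrices with
  inner dimension two, solved for the term with the corner entry \<open>c i j\<close>.
\<close>
lemma rank_two_minor:
  fixes x q y p :: "int \<Rightarrow> 'r::comm_ring_1"
  defines "c i j \<equiv> x i * y j - p j * q i"
  shows "(c u r * c v t - c u t * c v r) * c i j =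
    c u r * c v j * c i t - c u t * c v j * c i r - c u j * (c v r * c i t - c v t * c i r)"
  unfolding c_def by (simp add: algebra_simps)

text \<open>
  By the same factorization, a 2 by 2 minor is a product of two 2 by 2 determinants.
\<close>
lemma two_minor_nonzero:
  assumes "u \<noteq> v" "r \<noteq> t"
  shows "cell_binomial u r * cell_binomial v t - cell_binomial u t * cell_binomial v r
    \<noteq> (0 :: 'k::field edge_poly)"
proof -
  have "Var (XV u) * Var (QV v) - Var (XV v) * Var (QV u) \<noteq> (0 :: 'k edge_poly)"
    "Var (YV t) * Var (PV r) - Var (YV r) * Var (PV t) \<noteq> (0 :: 'k edge_poly)"
    using assms by (simp_all add: keys_binomial flip: keys_eq_empty)
  moreover have "cell_binomial u r * cell_binomial v t - cell_binomial u t * cell_binomial v r =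
      (Var (XV u) * Var (QV v) - Var (XV v) * Var (QV u)) *
      (Var (YV t) * Var (PV r) - Var (YV r) * Var (PV t) :: 'k edge_poly)"
    by (simp add: cell_binomial_def algebra_simps)
  ultimately show ?thesis by simp
qed

interpretation edge_poly: field_algebra "Const :: 'k::field \<Rightarrow> 'k edge_poly"
  by standard (simp_all add: Const_def single_add mult_single)

context skew_shape
begin

text \<open>
  A cell outside the two layers is the southeastern corner of a 3 by 3 block which lies in \<open>\<Gamma>\<close> by
  convexity, so \<open>rank_two_minor\<close> expresses its binomial through those of the eight other cells of
  the block. All of these have a smaller value of \<open>i + j\<close>.
\<close>
lemma cell_binomial_in_fractions:
  assumes "(i, j) \<in> \<Gamma>"
  shows "cell_binomial i j \<in>
    edge_poly.fractions ((\<lambda>(i, j). cell_binomial i j :: 'k::field edge_poly) ` NW_layers \<Gamma>)"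
    (is "_ \<in> edge_poly.fractions ?F")
  using assms
proof (induction "nat (i + j)" arbitrary: i j rule: less_induct)
  case less
  interpret subring_set "edge_poly.fractions ?F" by (rule edge_poly.subring_set_fractions)
  note bd = cell_bounds[OF less.prems]
  show ?case
  proof (cases "(i - 2, j - 2) \<in> \<Gamma>")
    case False
    then have "cell_binomial i j \<in> ?F"
      using less.prems by (force simp: NW_layers_def)
    moreover have "finite ?F"
      using finite_diagram by (auto intro: finite_subset simp: NW_layers_def)
    ultimately show ?thesis
      using edge_poly.polys_subset_fractions edge_poly.polysI[OF edge_poly.gen_bounded_polys]
      by blast
  next
    case True
    have mem: "(cell_binomial k l :: 'k edge_poly) \<in> edge_poly.fractions ?F"
      if "k \<in> {i - 2..i}" "l \<in> {j - 2..j}" "k + l < i + j" for k l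
    proof -
      have kl: "(k, l) \<in> \<Gamma>"
        using that by (intro rectangle_in_diagram[OF True less.prems]) auto
      show ?thesis
        using that(3) cell_bounds[OF kl] by (intro less.hyps[OF _ kl]) auto
    qed
    have minus: "f - g \<in> edge_poly.fractions ?F"
      if "f \<in> edge_poly.fractions ?F" "g \<in> edge_poly.fractions ?F" for f g
      using add_mem[OF that(1) uminus_mem[OF that(2)]] by simp
    define m :: "'k edge_poly" where
      "m = cell_binomial (i - 2) (j - 2) * cell_binomial (i - 1) (j - 1)
         - cell_binomial (i - 2) (j - 1) * cell_binomial (i - 1) (j - 2)"
    have "m \<in> edge_poly.fractions ?F"
      unfolding m_def by (intro minus mult_mem mem) auto
    moreover have "m \<noteq> 0"
      unfolding m_def by (rule two_minor_nonzero) auto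
    moreover have "m * cell_binomial i j \<in> edge_poly.fractions ?F"
      unfolding m_def cell_binomial_def
      unfolding rank_two_minor[where x = "\<lambda>i. Var (XV i)" and y = "\<lambda>j. Var (YV j)"
          and p = "\<lambda>j. Var (PV j)" and q = "\<lambda>i. Var (QV i)"]
      unfolding cell_binomial_def[symmetric]
      by (intro minus mult_mem mem) auto
    ultimately show ?thesis by (rule edge_poly.fractions_divide)
  qed
qed

definition edge_algebra :: "'k::field edge_poly set" where
  "edge_algebra = generate_ring (S_ring a b)
     (range Const \<union> edge_binomials (ferrers_graph a b \<Gamma>))"

lemma binomial_edge_ring_eq:
  "binomial_edge_ring a b (ferrers_graph a b \<Gamma>) = ring_on edge_algebra"
  by (simp add: binomial_edge_ring_def S_ring_def ring_on_def edge_algebra_def)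

lemma edge_binomials_eq:
  "edge_binomials (ferrers_graph a b \<Gamma>) = (\<lambda>(i, j). cell_binomial i j) ` \<Gamma>"
  by (auto simp: edge_binomials_ferrers_graph cell_binomial_def image_iff)

lemma generators_in_S_ring:
  "range Const \<union> edge_binomials (ferrers_graph a b \<Gamma>) \<subseteq> carrier (S_ring a b)"
proof -
  have "cell_binomial i j \<in> carrier (S_ring a b)" if "(i, j) \<in> \<Gamma>" for i j
    using cell_bounds[OF that] unfolding cell_binomial_def
    by (intro S_ring_closed Var_in_S_ring) (auto simp: S_vars_def)
  then show ?thesis by (auto simp: edge_binomials_eq Const_in_S_ring)
qed

lemma edge_algebra_gens:
  "Const c \<in> edge_algebra" "(i, j) \<in> \<Gamma> \<Longrightarrow> cell_binomial i j \<in> edge_algebra"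
  unfolding edge_algebra_def edge_binomials_eq
  by (auto intro!: generate_ring.incl)

lemma edge_algebra_minimal:
  fixes E :: "'k::field edge_poly set"
  assumes "subring_set E" "range Const \<subseteq> E"
    and "\<And>i j. (i, j) \<in> \<Gamma> \<Longrightarrow> cell_binomial i j \<in> E"
  shows "edge_algebra \<subseteq> E"
proof
  interpret subring_set E by fact
  interpret S: cring "S_ring a b :: 'k edge_poly ring" by (rule cring_S_ring)
  fix f :: "'k edge_poly" assume "f \<in> edge_algebra"
  then show "f \<in> E"
    unfolding edge_algebra_def
  proof (induction rule: generate_ring.induct)
    case (a_inv h)
    have "h \<in> carrier (S_ring a b)"
      using S.generate_ring_in_carrier[OF generators_in_S_ring a_inv(1)] .
    then have "\<ominus>\<^bsub>S_ring a b\<^esub> h = - h"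
      by (intro S.minus_equality) (auto simp: S_ring_closed, simp add: S_ring_def)
    then show ?case using uminus_mem[OF a_inv(2)] by simp
  qed (use assms one_mem add_mem mult_mem in \<open>auto simp: S_ring_def edge_binomials_eq\<close>)
qed

lemma subring_set_edge_algebra: "subring_set (edge_algebra :: 'k::field edge_poly set)"
proof
  show one: "1 \<in> (edge_algebra :: 'k edge_poly set)"
    using edge_algebra_gens(1)[of 1] by (simp add: edge_poly.s_one)
  show "f + g \<in> edge_algebra" if "f \<in> edge_algebra" "g \<in> edge_algebra" for f g :: "'k edge_poly"
    using generate_ring.eng_add[of f "S_ring a b" _ g] that
    by (simp add: edge_algebra_def S_ring_def)
  show mult: "f * g \<in> edge_algebra" if "f \<in> edge_algebra" "g \<in> edge_algebra" for f g :: "'k edge_poly"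
    using generate_ring.eng_mult[of f "S_ring a b" _ g] that
    by (simp add: edge_algebra_def S_ring_def)
  show "- f \<in> edge_algebra" if "f \<in> edge_algebra" for f :: "'k edge_poly"
    using mult[OF edge_algebra_gens(1)[of "- 1"] that] by (simp add: Const_def single_uminus)
qed

text \<open>
  The upper bound is \<open>chain_length_le\<close> for the binomials of the two layers; the lower bound is
  \<open>card_le_krull_dim\<close>, where the binomials of the same cells have pairwise different weights.
\<close>
lemma krull_dim_edge_algebra:
  "krull_dim (ring_on (edge_algebra :: 'k::field edge_poly set)) = enat (card (NW_layers \<Gamma>))"
proof (rule antisym)
  let ?A = "edge_algebra :: 'k edge_poly set"
  let ?F = "(\<lambda>(i, j). cell_binomial i j :: 'k edge_poly) ` NW_layers \<Gamma>"
  have fin: "finite (NW_layers \<Gamma>)"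
    using finite_diagram by (auto intro: finite_subset simp: NW_layers_def)
  have sub: "?A \<subseteq> edge_poly.fractions ?F"
  proof (rule edge_algebra_minimal)
    show "range Const \<subseteq> edge_poly.fractions ?F"
      using edge_poly.polysI[OF edge_poly.scalar_bounded_polys]
        edge_poly.polys_subset_fractions[of ?F] by blast
  qed (rule edge_poly.subring_set_fractions, rule cell_binomial_in_fractions)
  show "krull_dim (ring_on ?A) \<le> enat (card (NW_layers \<Gamma>))"
    unfolding krull_dim_def
  proof (rule Sup_least, clarify)
    fix n and p :: "nat \<Rightarrow> 'k edge_poly set"
    assume *: "\<forall>i\<le>n. primeideal (p i) (ring_on ?A)" "\<forall>i<n. p i \<subset> p (Suc i)"
    have "range Const \<subseteq> ?A" using edge_algebra_gens(1) by auto
    then have "n \<le> card ?F"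
      by (rule edge_poly.chain_length_le[OF subring_set_edge_algebra _ finite_imageI[OF fin] sub,
            where p = p]) (use * in simp_all)
    also have "\<dots> \<le> card (NW_layers \<Gamma>)" by (rule card_image_le[OF fin])
    finally show "enat n \<le> enat (card (NW_layers \<Gamma>))" by simp
  qed
  let ?C = "(\<lambda>(i, j). cell_weight layer_weight i j) ` NW_layers \<Gamma>"
  have "enat (card ?C) \<le> krull_dim (ring_on ?A)"
  proof (rule card_le_krull_dim[OF subring_set_edge_algebra, where w = layer_weight])
    show "finite ?C" using fin by simp
    fix t assume "t \<in> ?C"
    then obtain i j where "(i, j) \<in> \<Gamma>" "t = cell_weight layer_weight i j"
      by (auto simp: NW_layers_def)
    then show "\<exists>f\<in>?A. \<forall>s. f \<in> var_ideal {v. s \<le> layer_weight v} \<longleftrightarrow> s \<le> t"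
      by (intro bexI[of _ "cell_binomial i j"] edge_algebra_gens)
        (simp_all add: cell_binomial_in_threshold_ideal_iff)
  qed
  then show "enat (card (NW_layers \<Gamma>)) \<le> krull_dim (ring_on ?A)"
    by (simp add: card_image[OF inj_on_cell_weight])
qed

end

theorem theorem5p3:
  fixes a b :: int and lam mu :: "int \<Rightarrow> int"
    and \<Gamma> P :: "(int \<times> int) set"
    and \<G> :: "edge_var set \<times> edge_var set set"
  assumes "a \<ge> 1"
    and "\<And>i. 1 \<le> i \<Longrightarrow> i \<le> a \<Longrightarrow> lam i \<ge> 1"
    and "\<And>i. 1 \<le> i \<Longrightarrow> i \<le> a \<Longrightarrow> mu i \<ge> 0"
    and "\<And>i. 1 \<le> i \<Longrightarrow> i < a \<Longrightarrow> lam i \<ge> lam (i + 1)"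
    and "\<And>i. 1 \<le> i \<Longrightarrow> i < a \<Longrightarrow> mu i \<ge> mu (i + 1)"
    and "\<And>i. 1 \<le> i \<Longrightarrow> i \<le> a \<Longrightarrow> lam i \<ge> mu i"
    and "b = lam 1"
    and "\<Gamma> = skew_diagram a lam mu"
    and "\<G> = ferrers_graph a b \<Gamma>"
    and "P = NW_perimeter \<Gamma> \<union> SE_perimeter \<Gamma>"
  shows "krull_dim (binomial_edge_ring a b \<G> :: 'k::field edge_poly ring) = enat (card P)"
proof -
  interpret skew_shape a b lam mu
    using assms by unfold_locales auto
  show ?thesis
    using krull_dim_edge_algebra card_NW_layers
    by (simp add: assms(8-10) binomial_edge_ring_eq)
qed

end
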